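(* Let $I\subset\mathbb{R}$ be an interval with interior $I^{\circ}$, let $a,b\in I^{\circ}$ with $a<b$, and let $f:I\to\mathbb{R}$ be twice differentiable on $I^{\circ}$ with $f,f',f''\in L[a,b]$. Let $\alpha,\lambda\in[0,1]$ and let $q\ge 1$ be real. Suppose $|f''|^q$ is convex on $[a,b]$. Put $$E=(b-a)\left(\alpha-\tfrac12\right)f'\big((1-\alpha)b+\alpha a\big)-\frac{1}{b-a}\int_a^b f(x)\,dx+(1-\lambda)f\big((1-\alpha)b+\alpha a\big)+\lambda\big(\alpha f(a)+(1-\alpha)f(b)\big).$$ Then, with the constants $\tau_1,\tau_2,z_1,z_2$ and $\gamma_i,\mu_i$ ($i=1,2,3,4$) given in the context: (i) if $2\alpha\lambda\le 1-\alpha\le 1-2\lambda(1-\alpha)$, then $$|E|\le\tfrac{(b-a)^2}{2}\left[\tau_1^{1-\frac1q}\big(\gamma_1|f''(b)|^q+\gamma_2|f''(a)|^q\big)^{\frac1q}+z_1^{1-\frac1q}\big(\mu_1|f''(b)|^q+\mu_2|f''(a)|^q\big)^{\frac1q}\right];$$ (ii) if $1-\alpha\ge\max\{2\alpha\lambda,\,1-2\lambda(1-\alpha)\}$, then $$|E|\le\tfrac{(b-a)^2}{2}\left[\tau_1^{1-\frac1q}\big(\gamma_1|f''(b)|^q+\gamma_2|f''(a)|^q\big)^{\frac1q}+z_2^{1-\frac1q}\big(\mu_3|f''(b)|^q+\mu_4|f''(a)|^q\big)^{\frac1q}\right];$$ (iii) if $1-\alpha\le\min\{2\alpha\lambda,\,1-2\lambda(1-\alpha)\}$,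 then $$|E|\le\tfrac{(b-a)^2}{2}\left[\tau_2^{1-\frac1q}\big(\gamma_3|f''(b)|^q+\gamma_4|f''(a)|^q\big)^{\frac1q}+z_1^{1-\frac1q}\big(\mu_1|f''(b)|^q+\mu_2|f''(a)|^q\big)^{\frac1q}\right];$$ (iv) if $1-2\lambda(1-\alpha)\le 1-\alpha\le 2\alpha\lambda$, then $$|E|\le\tfrac{(b-a)^2}{2}\left[\tau_2^{1-\frac1q}\big(\gamma_3|f''(b)|^q+\gamma_4|f''(a)|^q\big)^{\frac1q}+z_2^{1-\frac1q}\big(\mu_3|f''(b)|^q+\mu_4|f''(a)|^q\big)^{\frac1q}\right].$$
   Context: $L[a,b]$ denotes the Lebesgue integrable real-valued functions on $[a,b]$. For $q=1$ the factors with exponent $1-\frac1q=0$ equal $1$. The constants are $$\tau_1=\tfrac83(\alpha\lambda)^3+(1-\alpha)^2\left(\tfrac{1-\alpha}{3}-\alpha\lambda\right),\qquad \tau_2=(1-\alpha)^2\left(\alpha\lambda-\tfrac{1-\alpha}{3}\right),$$ $$z_1=\tfrac43(1-\alpha)^3\lambda^3+\tfrac13\big(\alpha-2\lambda(1-\alpha)\big)^2\big(\alpha(1-\lambda)+\lambda\big),$$ $$z_2=\tfrac43(1-\alpha)^3\lambda^3-\tfrac13\big(\alpha-2\lambda(1-\alpha)\big)^2\big(\alpha(1-\lambda)+\lambda\big),$$ $$\gamma_1=\tfrac83(\alpha\lambda)^4+(1-\alpha)^3\left(\tfrac{1-\alpha}{4}-\tfrac{2\alpha\lambda}{3}\right),$$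 $$\gamma_2=\tfrac83(\alpha\lambda)^3(1-\alpha\lambda)+(1-\alpha)^2\left[\tfrac{1-\alpha}{3}-\alpha\lambda-\tfrac{(1-\alpha)^2}{4}+\tfrac{2\alpha\lambda(1-\alpha)}{3}\right],$$ $$\gamma_3=\tfrac{2\alpha\lambda(1-\alpha)^3}{3}-\tfrac{(1-\alpha)^4}{4},$$ $$\gamma_4=(1-\alpha)^2\left[\alpha\lambda-\tfrac{1-\alpha}{3}-\tfrac{2\alpha\lambda(1-\alpha)}{3}+\tfrac{(1-\alpha)^2}{4}\right],$$ $$\mu_1=\tfrac43(1-\alpha)^3\lambda^3\big(1-\lambda(1-\alpha)\big)-\tfrac1{12}\big(\alpha-2\lambda(1-\alpha)\big)^2\left[\alpha(3\alpha-4)-4\lambda(1-\alpha)^2(1-\lambda)\right],$$ $$\mu_2=\tfrac43(1-\alpha)^4\lambda^4+\tfrac1{12}\big(\alpha-2\lambda(1-\alpha)\big)^2\left[\alpha^2(4\lambda^2-4\lambda+3)+4\alpha\lambda(1-2\lambda)+4\lambda^2\right],$$ $$\mu_3=\tfrac43(1-\alpha)^3\lambda^3\big(1-\lambda(1-\alpha)\big)+\tfrac1{12}\big(\alpha-2\lambda(1-\alpha)\big)^2\left[\alpha(3\alpha-4)-4\lambda(1-\alpha)^2(1-\lambda)\right],$$ $$\mu_4=\tfrac43(1-\alpha)^4\lambda^4-\tfrac1{12}\big(\alpha-2\lambda(1-\alpha)\big)^2\left[\alpha^2(4\lambda^2-4\lambda+3)+4\alpha\lambda(1-2\lambda)+4\lambda^2\right].$$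 *)

theory Defs
  imports "HOL-Analysis.Analysis"
begin

text \<open>
  Throughout, \<open>\<alpha>\<close> and \<open>l\<close> are the two parameters in \<open>[0,1]\<close>;
  \<open>l\<close> is written for the usual \<open>lambda\<close>.
\<close>

definition tau1 :: "real \<Rightarrow> real \<Rightarrow> real" where
  "tau1 \<alpha> l = 8/3 * (\<alpha> * l)^3 + (1 - \<alpha>)^2 * ((1 - \<alpha>)/3 - \<alpha> * l)"

definition tau2 :: "real \<Rightarrow> real \<Rightarrow> real" where
  "tau2 \<alpha> l = (1 - \<alpha>)^2 * (\<alpha> * l - (1 - \<alpha>)/3)"

definition z1 :: "real \<Rightarrow> real \<Rightarrow> real" where
  "z1 \<alpha> l = 4/3 * (1 - \<alpha>)^3 * l^3
     + 1/3 * (\<alpha> - 2 * l * (1 - \<alpha>))^2 * (\<alpha> * (1 - l) + l)"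

definition z2 :: "real \<Rightarrow> real \<Rightarrow> real" where
  "z2 \<alpha> l = 4/3 * (1 - \<alpha>)^3 * l^3
     - 1/3 * (\<alpha> - 2 * l * (1 - \<alpha>))^2 * (\<alpha> * (1 - l) + l)"

definition gamma1 :: "real \<Rightarrow> real \<Rightarrow> real" where
  "gamma1 \<alpha> l = 8/3 * (\<alpha> * l)^4 + (1 - \<alpha>)^3 * ((1 - \<alpha>)/4 - 2 * \<alpha> * l / 3)"

definition gamma2 :: "real \<Rightarrow> real \<Rightarrow> real" where
  "gamma2 \<alpha> l = 8/3 * (\<alpha> * l)^3 * (1 - \<alpha> * l)
     + (1 - \<alpha>)^2 * ((1 - \<alpha>)/3 - \<alpha> * l - (1 - \<alpha>)^2 / 4 + 2 * \<alpha> * l * (1 - \<alpha>) / 3)"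

definition gamma3 :: "real \<Rightarrow> real \<Rightarrow> real" where
  "gamma3 \<alpha> l = 2 * \<alpha> * l * (1 - \<alpha>)^3 / 3 - (1 - \<alpha>)^4 / 4"

definition gamma4 :: "real \<Rightarrow> real \<Rightarrow> real" where
  "gamma4 \<alpha> l =
     (1 - \<alpha>)^2 * (\<alpha> * l - (1 - \<alpha>)/3 - 2 * \<alpha> * l * (1 - \<alpha>) / 3 + (1 - \<alpha>)^2 / 4)"

definition mu1 :: "real \<Rightarrow> real \<Rightarrow> real" where
  "mu1 \<alpha> l = 4/3 * (1 - \<alpha>)^3 * l^3 * (1 - l * (1 - \<alpha>))
     - 1/12 * (\<alpha> - 2 * l * (1 - \<alpha>))^2 * (\<alpha> * (3 * \<alpha> - 4) - 4 * l * (1 - \<alpha>)^2 * (1 - l))"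

definition mu2 :: "real \<Rightarrow> real \<Rightarrow> real" where
  "mu2 \<alpha> l = 4/3 * (1 - \<alpha>)^4 * l^4
     + 1/12 * (\<alpha> - 2 * l * (1 - \<alpha>))^2
         * (\<alpha>^2 * (4 * l^2 - 4 * l + 3) + 4 * \<alpha> * l * (1 - 2 * l) + 4 * l^2)"

definition mu3 :: "real \<Rightarrow> real \<Rightarrow> real" where
  "mu3 \<alpha> l = 4/3 * (1 - \<alpha>)^3 * l^3 * (1 - l * (1 - \<alpha>))
     + 1/12 * (\<alpha> - 2 * l * (1 - \<alpha>))^2 * (\<alpha> * (3 * \<alpha> - 4) - 4 * l * (1 - \<alpha>)^2 * (1 - l))"

definition mu4 :: "real \<Rightarrow> real \<Rightarrow> real" where
  "mu4 \<alpha> l = 4/3 * (1 - \<alpha>)^4 * l^4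
     - 1/12 * (\<alpha> - 2 * l * (1 - \<alpha>))^2
         * (\<alpha>^2 * (4 * l^2 - 4 * l + 3) + 4 * \<alpha> * l * (1 - 2 * l) + 4 * l^2)"

text \<open>
  Real power with the convention that exponent \<open>0\<close> always gives \<open>1\<close>.
  For \<open>powr\<close> alone, \<open>0 powr 0 = 0\<close>; the two differ only there.
\<close>

definition rpow :: "real \<Rightarrow> real \<Rightarrow> real" where
  "rpow x p = (if p = 0 then 1 else x powr p)"

text \<open>The argument \<open>f'\<close> is the derivative of \<open>f\<close>.\<close>

definition quad_error ::
    "(real \<Rightarrow> real) \<Rightarrow> (real \<Rightarrow> real) \<Rightarrow> real \<Rightarrow> real \<Rightarrow> real \<Rightarrow> real \<Rightarrow> real" where
  "quad_error f f' a b \<alpha> l =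
     (b - a) * (\<alpha> - 1/2) * f' ((1 - \<alpha>) * b + \<alpha> * a)
     - 1 / (b - a) * (LINT x:{a..b}|lebesgue. f x)
     + (1 - l) * f ((1 - \<alpha>) * b + \<alpha> * a)
     + l * (\<alpha> * f a + (1 - \<alpha>) * f b)"

end

theory Submission
  imports Defs
begin

text \<open>
  Put \<open>g t = f (a + t * (b - a))\<close>. Integrating \<open>t * (t - p) * g'' t\<close> by parts over \<open>[0, 1 - \<alpha>]\<close> with
  \<open>p = 2 * \<alpha> * l\<close>, and likewise from the other end over \<open>[0, \<alpha>]\<close> with
  \<open>p = 2 * l * (1 - \<alpha>)\<close>, and adding, gives \<open>-2\<close> times the quadrature error.
  By convexity \<open>\<bar>f''\<bar>\<close> is at most \<open>(t * B + (1 - t) * A) powr (1/q)\<close>, where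
  \<open>A\<close> and \<open>B\<close> are the values of \<open>\<bar>f''\<bar> powr q\<close> at the end points. Instead of applying
  Hoelder's inequality one replaces the concave power by its tangent at a point \<open>m\<close>, so that only
  polynomials are integrated against the kernel, and then optimises over \<open>m\<close>.
\<close>

text \<open>The integrals of \<open>\<bar>t * (t - p)\<bar>\<close> and \<open>t * \<bar>t * (t - p)\<bar>\<close> over \<open>0 \<le> t \<le> c\<close>.\<close>

definition kernel_mass :: "real \<Rightarrow> real \<Rightarrow> real" where
  "kernel_mass p c = (if p \<le> c then p^3/3 + c^3/3 - p*c^2/2 else p*c^2/2 - c^3/3)"

definition kernel_moment :: "real \<Rightarrow> real \<Rightarrow> real" where
  "kernel_moment p c = (if p \<le> c then p^4/6 + c^4/4 - p*c^3/3 else p*c^3/3 - c^4/4)"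

section \<open>Sign and size of the kernel integrals\<close>

text \<open>In \<open>c\<close> the first formula has derivative \<open>c * (c - p)\<close>, so over
  \<open>0 \<le> c\<close> it is least at \<open>c = p\<close>, with value \<open>p^3/6\<close>;
  subtracting this value leaves the double zero \<open>(c-p)^2\<close>. The next lemma splits off
  \<open>p^4/12\<close> in the same way.\<close>

lemma kernel_mass_nonneg:
  assumes "0 \<le> p" "0 \<le> c"
  shows "0 \<le> kernel_mass p c"
proof (cases "p \<le> c")
  case True
  have "p^3/3 + c^3/3 - p*c^2/2 = (c-p)^2 * (c/3 + p/6) + p^3/6"
    by (simp add: field_simps power2_eq_square power3_eq_cube)
  moreover have "0 \<le> (c-p)^2 * (c/3 + p/6) + p^3/6" using assms by simp
  ultimately show ?thesis using True by (simp add: kernel_mass_def)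
next
  case False
  have "p*c^2/2 - c^3/3 = c^2 * (3*p - 2*c) / 6"
    by (simp add: field_simps power2_eq_square power3_eq_cube)
  moreover have "0 \<le> c^2 * (3*p - 2*c) / 6" using assms False by simp
  ultimately show ?thesis using False by (simp add: kernel_mass_def)
qed

lemma kernel_moment_nonneg:
  assumes "0 \<le> p" "0 \<le> c"
  shows "0 \<le> kernel_moment p c"
proof (cases "p \<le> c")
  case True
  have "p^4/6 + c^4/4 - p*c^3/3 = p^4/12 + (c-p)^2 * (3*c^2 + 2*c*p + p^2) / 12"
    by (simp add: field_simps power2_eq_square power3_eq_cube power4_eq_xxxx)
  moreover have "0 \<le> p^4/12 + (c-p)^2 * (3*c^2 + 2*c*p + p^2) / 12" using assms by simp
  ultimately show ?thesis using True by (simp add: kernel_moment_def)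
next
  case False
  have "p*c^3/3 - c^4/4 = c^3 * (4*p - 3*c) / 12"
    by (simp add: field_simps power3_eq_cube power4_eq_xxxx)
  moreover have "0 \<le> c^3 * (4*p - 3*c) / 12" using assms False by simp
  ultimately show ?thesis using False by (simp add: kernel_moment_def)
qed

text \<open>Since \<open>t \<le> c \<le> 1\<close> on the range of integration, the factor
  \<open>t\<close> in the moment is at most \<open>1\<close>. The lemma makes
  \<open>kernel_mass - kernel_moment\<close>, the weight of the end point \<open>t = 0\<close>,
  nonnegative.\<close>

lemma kernel_moment_le_mass:
  assumes "0 \<le> p" "0 \<le> c" "c \<le> 1"
  shows "kernel_moment p c \<le> kernel_mass p c"
proof -
  have "kernel_moment p c \<le> c * kernel_mass p c"
  proof (cases "p \<le> c")
    case True
    \<comment> \<open>This is the integral of \<open>(c - t) * \<bar>t * (t - p)\<bar>\<close> over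
      \<open>[0, c]\<close>: the first summand on the right is the part over \<open>[0, p]\<close>,
      the other two are the part over \<open>[p, c]\<close>.\<close>
    have "c * (p^3/3 + c^3/3 - p*c^2/2) - (p^4/6 + c^4/4 - p*c^3/3)
        = p^3 * (2*c - p) / 12 + (c-p)^4/12 + p * (c-p)^3/6"
      by (simp add: field_simps power2_eq_square power3_eq_cube power4_eq_xxxx)
    moreover have "0 \<le> p^3 * (2*c - p) / 12 + (c-p)^4/12 + p * (c-p)^3/6"
      using assms True by simp
    ultimately show ?thesis using True by (simp add: kernel_mass_def kernel_moment_def)
  next
    case False
    have "c * (p*c^2/2 - c^3/3) - (p*c^3/3 - c^4/4) = c^3 * (2*p - c) / 12"
      by (simp add: field_simps power2_eq_square power3_eq_cube power4_eq_xxxx)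
    moreover have "0 \<le> c^3 * (2*p - c) / 12" using assms False by simp
    ultimately show ?thesis using False by (simp add: kernel_mass_def kernel_moment_def)
  qed
  also have "\<dots> \<le> kernel_mass p c"
    using kernel_mass_nonneg[of p c] assms by (simp add: mult_left_le_one_le)
  finally show ?thesis .
qed

section \<open>Tangents in place of Hoelder's inequality\<close>

text \<open>Weighted AM-GM for \<open>x\<close> and \<open>m\<close>, multiplied by
  \<open>m powr (\<theta> - 1)\<close>. The right-hand side is the tangent of the concave power at
  \<open>m\<close>.\<close>

lemma powr_le_tangent:
  fixes x m \<theta> :: real
  assumes "0 \<le> x" "0 < m" "0 < \<theta>" "\<theta> \<le> 1"
  shows "x powr \<theta> \<le> m powr \<theta> + \<theta> * m powr (\<theta> - 1) * (x - m)"
proof -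
  have "x powr \<theta> * m powr (1 - \<theta>) \<le> \<theta> * x + (1 - \<theta>) * m"
    using assms Youngs_inequality_0[of \<theta> "1 - \<theta>" x m] by (cases "x = 0") auto
  hence "x powr \<theta> * m powr (1 - \<theta>) * m powr (\<theta> - 1) \<le> (\<theta> * x + (1 - \<theta>) * m) * m powr (\<theta> - 1)"
    by (rule mult_right_mono) simp
  moreover have "m powr (1 - \<theta>) * m powr (\<theta> - 1) = 1"
    using assms by (simp flip: powr_add)
  moreover have "m * m powr (\<theta> - 1) = m powr \<theta>"
    using assms by (simp add: powr_mult_base)
  ultimately show ?thesis by (simp add: algebra_simps)
qed

text \<open>The right-hand side of the hypothesis is minimal at \<open>m = M / W\<close>; when \<open>M = 0\<close> this is the
  limit \<open>m \<rightarrow> 0\<close>.\<close>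

lemma le_powr_from_tangents:
  fixes T W M \<theta> :: real
  assumes \<theta>: "0 < \<theta>" "\<theta> \<le> 1" and W: "0 \<le> W" and M: "0 \<le> M" and WM: "W = 0 \<Longrightarrow> M = 0"
    and bound: "\<And>m. 0 < m \<Longrightarrow> T \<le> W * m powr \<theta> + \<theta> * m powr (\<theta> - 1) * (M - W * m)"
  shows "T \<le> rpow W (1 - \<theta>) * M powr \<theta>"
proof (cases "W = 0")
  case True
  \<comment> \<open>Here \<open>M = 0\<close> as well, so the bound reads \<open>T \<le> 0\<close>,
    and the right-hand side is \<open>0\<close> because of its factor
    \<open>0 powr \<theta>\<close>, whatever the value of \<open>rpow\<close>.\<close>
  then show ?thesis using bound[of 1] WM by simp
next
  case False
  with W have W: "0 < W" by simp
  show ?thesis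
  proof (cases "M = 0")
    case True
    have "T \<le> W * (1 - \<theta>) * m powr \<theta>" if "0 < m" for m
      using bound[OF that] True that by (simp add: algebra_simps powr_mult_base)
    moreover have "((\<lambda>m. W * (1 - \<theta>) * m powr \<theta>) \<longlongrightarrow> W * (1 - \<theta>) * 0 powr \<theta>) (at_right 0)"
      using \<theta> by (intro tendsto_intros tendsto_powr')
        (auto intro: eventually_mono[OF eventually_at_right_less])
    ultimately have "T \<le> W * (1 - \<theta>) * 0 powr \<theta>"
      by (intro tendsto_lowerbound[where F = "at_right 0"])
         (auto intro: eventually_mono[OF eventually_at_right_less])
    then show ?thesis using True by simp
  next
    case False
    with M have M: "0 < M" by simp
    have "T \<le> W * (M / W) powr \<theta>"
      using bound[of "M / W"] M W by simp
    also have "\<dots> = W powr (1 - \<theta>) * M powr \<theta>"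
      using M W by (simp add: powr_divide powr_diff)
    \<comment> \<open>\<open>rpow\<close> and \<open>powr\<close> differ only at base and exponent
      \<open>0\<close>, which \<open>0 < W\<close> excludes, even for
      \<open>\<theta> = 1\<close>.\<close>
    also have "\<dots> = rpow W (1 - \<theta>) * M powr \<theta>"
      using W by (simp add: rpow_def)
    finally show ?thesis .
  qed
qed

section \<open>Integrals of the kernel against a second derivative\<close>

text \<open>Two integrations by parts give \<open>H\<close> as a primitive of
  \<open>t * (t - p) * g'' t\<close>, and \<open>Q\<close> is a primitive of the kernel times the
  majorant. With \<open>e\<close> the sign of the kernel, \<open>e * Q - H\<close> and
  \<open>e * Q + H\<close> are both nondecreasing; comparing primitives replaces integrating
  \<open>g''\<close>.\<close>

lemma kernel_integral_piece:
  fixes G g g' g'' :: "real \<Rightarrow> real" and p u v e x y :: real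
  defines "H \<equiv> \<lambda>t. t * (t - p) * g' t - (2 * t - p) * g t + 2 * G t"
    and "Q \<equiv> \<lambda>t. u * (t^3/3 - p*t^2/2) + v * (t^4/4 - p*t^3/3)"
  assumes "x \<le> y"
    and G: "\<And>t. x \<le> t \<Longrightarrow> t \<le> y \<Longrightarrow> (G has_real_derivative g t) (at t)"
    and g: "\<And>t. x \<le> t \<Longrightarrow> t \<le> y \<Longrightarrow> (g has_real_derivative g' t) (at t)"
    and g': "\<And>t. x \<le> t \<Longrightarrow> t \<le> y \<Longrightarrow> (g' has_real_derivative g'' t) (at t)"
    and bound: "\<And>t. x \<le> t \<Longrightarrow> t \<le> y \<Longrightarrow> \<bar>g'' t\<bar> \<le> u + v * t"
    and e: "\<bar>e\<bar> = 1" "\<And>t. x \<le> t \<Longrightarrow> t \<le> y \<Longrightarrow> 0 \<le> e * (t * (t - p))"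
  shows "\<bar>H y - H x\<bar> \<le> e * (Q y - Q x)"
proof -
  have H: "(H has_real_derivative t * (t - p) * g'' t) (at t)" if "x \<le> t" "t \<le> y" for t
    unfolding H_def
    using G[OF that] g[OF that] g'[OF that]
    by (auto intro!: derivative_eq_intros simp: algebra_simps)
  have Q: "(Q has_real_derivative t * (t - p) * (u + v * t)) (at t)" for t
    unfolding Q_def
    by (auto intro!: derivative_eq_intros simp: field_simps power2_eq_square power3_eq_cube)
  have *: "\<bar>t * (t - p) * g'' t\<bar> \<le> e * (t * (t - p) * (u + v * t))" if "x \<le> t" "t \<le> y" for t
  proof -
    have "\<bar>t * (t - p) * g'' t\<bar> = e * (t * (t - p)) * \<bar>g'' t\<bar>"
      using e(1) e(2)[OF that] by (metis abs_mult abs_of_nonneg mult_1)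
    also have "\<dots> \<le> e * (t * (t - p)) * (u + v * t)"
      using bound[OF that] e(2)[OF that] by (rule mult_left_mono)
    finally show ?thesis by (simp add: mult.assoc)
  qed
  have "e * Q x - H x \<le> e * Q y - H y"
  proof (rule DERIV_nonneg_imp_nondecreasing[OF \<open>x \<le> y\<close>])
    fix t assume t: "x \<le> t" "t \<le> y"
    show "\<exists>d. ((\<lambda>t. e * Q t - H t) has_real_derivative d) (at t) \<and> 0 \<le> d"
      using DERIV_diff[OF DERIV_cmult[OF Q, of e t] H[OF t]] *[OF t]
      by (intro exI[of _ "e * (t * (t - p) * (u + v * t)) - t * (t - p) * g'' t"] conjI) auto
  qed
  moreover have "e * Q x + H x \<le> e * Q y + H y"
  proof (rule DERIV_nonneg_imp_nondecreasing[OF \<open>x \<le> y\<close>])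
    fix t assume t: "x \<le> t" "t \<le> y"
    show "\<exists>d. ((\<lambda>t. e * Q t + H t) has_real_derivative d) (at t) \<and> 0 \<le> d"
      using DERIV_add[OF DERIV_cmult[OF Q, of e t] H[OF t]] *[OF t]
      by (intro exI[of _ "e * (t * (t - p) * (u + v * t)) + t * (t - p) * g'' t"] conjI) auto
  qed
  ultimately show ?thesis by (simp add: algebra_simps abs_le_iff)
qed

text \<open>The quantity estimated is \<open>H c - H 0\<close> for the primitive \<open>H\<close> of
  the previous lemma; \<open>g' 0\<close> is absent because the kernel vanishes at \<open>0\<close>.
  The kernel is nonpositive up to \<open>p\<close> and nonnegative after it, so for
  \<open>p \<le> c\<close> the interval is cut at \<open>p\<close>.\<close>

lemma kernel_integral_bound_affine:
  fixes G g g' g'' :: "real \<Rightarrow> real" and p u v c :: real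
  assumes p: "0 \<le> p" and c: "0 \<le> c"
    and G: "\<And>t. 0 \<le> t \<Longrightarrow> t \<le> c \<Longrightarrow> (G has_real_derivative g t) (at t)"
    and g: "\<And>t. 0 \<le> t \<Longrightarrow> t \<le> c \<Longrightarrow> (g has_real_derivative g' t) (at t)"
    and g': "\<And>t. 0 \<le> t \<Longrightarrow> t \<le> c \<Longrightarrow> (g' has_real_derivative g'' t) (at t)"
    and bound: "\<And>t. 0 \<le> t \<Longrightarrow> t \<le> c \<Longrightarrow> \<bar>g'' t\<bar> \<le> u + v * t"
  shows "\<bar>c * (c - p) * g' c - (2 * c - p) * g c - p * g 0 + 2 * (G c - G 0)\<bar>
           \<le> u * kernel_mass p c + v * kernel_moment p c"
proof (cases "p \<le> c")
  case True
  have pos: "0 \<le> (-1) * (t * (t - p))" if "0 \<le> t" "t \<le> p" for t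
    using that by (simp add: mult_nonneg_nonpos)
  note lower = kernel_integral_piece[where x = 0 and y = p and e = "-1" and p = p and u = u
      and v = v and G = G and g = g and g' = g' and g'' = g'', OF p G g g' bound _ pos]
  have pos': "0 \<le> 1 * (t * (t - p))" if "p \<le> t" "t \<le> c" for t
    using that p by simp
  note upper = kernel_integral_piece[where x = p and y = c and e = 1 and p = p and u = u
      and v = v and G = G and g = g and g' = g' and g'' = g'', OF True G g g' bound _ pos']
  show ?thesis
    using lower upper p True
    by (simp add: kernel_mass_def kernel_moment_def algebra_simps power2_eq_square
        power3_eq_cube power4_eq_xxxx)
next
  case False
  have pos: "0 \<le> (-1) * (t * (t - p))" if "0 \<le> t" "t \<le> c" for t
    using that False by (simp add: mult_nonneg_nonpos)
  show ?thesis
    using kernel_integral_piece[where x = 0 and y = c and e = "-1" and p = p and u = u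
      and v = v and G = G and g = g and g' = g' and g'' = g'', OF c G g g' bound _ pos] False
    by (simp add: kernel_mass_def kernel_moment_def algebra_simps)
qed

text \<open>\<open>?W\<close> is the total mass of the absolute kernel and \<open>?M\<close> the
  integral of the chord \<open>t * B + (1 - t) * A\<close> against it. \<open>D\<close> stands for
  the squared length of the interval, which rescaling to \<open>[0, 1]\<close> brings in.\<close>

lemma kernel_integral_bound:
  fixes G g g' g'' :: "real \<Rightarrow> real" and p c A B D q :: real
  assumes p: "0 \<le> p" and c: "0 \<le> c" "c \<le> 1" and q: "1 \<le> q" and AB: "0 \<le> A" "0 \<le> B" and D: "0 < D"
    and G: "\<And>t. 0 \<le> t \<Longrightarrow> t \<le> c \<Longrightarrow> (G has_real_derivative g t) (at t)"
    and g: "\<And>t. 0 \<le> t \<Longrightarrow> t \<le> c \<Longrightarrow> (g has_real_derivative g' t) (at t)"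
    and g': "\<And>t. 0 \<le> t \<Longrightarrow> t \<le> c \<Longrightarrow> (g' has_real_derivative D * g'' t) (at t)"
    and bound: "\<And>t. 0 \<le> t \<Longrightarrow> t \<le> c \<Longrightarrow> \<bar>g'' t\<bar> powr q \<le> t * B + (1 - t) * A"
  shows "\<bar>c * (c - p) * g' c - (2 * c - p) * g c - p * g 0 + 2 * (G c - G 0)\<bar>
    \<le> D * (rpow (kernel_mass p c) (1 - 1/q) *
        (kernel_moment p c * B + (kernel_mass p c - kernel_moment p c) * A) powr (1/q))"
    (is "?T \<le> D * (rpow ?W _ * ?M powr _)")
proof -
  define \<theta> where "\<theta> = 1 / q"
  have \<theta>: "0 < \<theta>" "\<theta> \<le> 1" using q by (auto simp: \<theta>_def)
  have W: "0 \<le> ?W" and V: "0 \<le> kernel_moment p c" and VW: "kernel_moment p c \<le> ?W"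
    using kernel_mass_nonneg kernel_moment_nonneg kernel_moment_le_mass p c by auto
  have "?T / D \<le> rpow ?W (1 - \<theta>) * ?M powr \<theta>"
  proof (rule le_powr_from_tangents[OF \<theta> W])
    show "0 \<le> ?M" using V VW AB by simp
    show "?M = 0" if "?W = 0" using that V VW by simp
    fix m :: real assume m: "0 < m"
    define d where "d = \<theta> * m powr (\<theta> - 1)"
    \<comment> \<open>The tangent at \<open>m\<close>, evaluated along the chord, is affine in
      \<open>t\<close>; its constant term and its slope, times \<open>D\<close>, serve as
      \<open>u\<close> and \<open>v\<close>.\<close>
    have "?T \<le> D * (m powr \<theta> + d * (A - m)) * ?W + D * d * (B - A) * kernel_moment p c"
    proof (rule kernel_integral_bound_affine[OF p c(1) G g g'])
      fix t assume t: "0 \<le> t" "t \<le> c"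
      have "\<bar>g'' t\<bar> = (\<bar>g'' t\<bar> powr q) powr \<theta>"
        using q by (simp add: \<theta>_def powr_powr)
      also have "\<dots> \<le> (t * B + (1 - t) * A) powr \<theta>"
        using bound[OF t] \<theta> by (intro powr_mono2) auto
      also have "\<dots> \<le> m powr \<theta> + d * (t * B + (1 - t) * A - m)"
        unfolding d_def using t c AB m \<theta> by (intro powr_le_tangent) auto
      finally have "D * \<bar>g'' t\<bar> \<le> D * (m powr \<theta> + d * (t * B + (1 - t) * A - m))"
        using D by simp
      then show "\<bar>D * g'' t\<bar> \<le> D * (m powr \<theta> + d * (A - m)) + D * d * (B - A) * t"
        using D by (simp add: abs_mult algebra_simps)
    qed
    also have "\<dots> = (?W * m powr \<theta> + d * (?M - ?W * m)) * D"
      by (simp add: algebra_simps)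
    finally show "?T / D \<le> ?W * m powr \<theta> + \<theta> * m powr (\<theta> - 1) * (?M - ?W * m)"
      using D by (simp add: d_def pos_divide_le_eq)
  qed
  then show ?thesis using D by (simp add: \<theta>_def pos_divide_le_eq mult.commute)
qed

section \<open>The constants of the theorem as kernel integrals\<close>

lemma tau1_gamma_eq_kernel:
  assumes "2 * \<alpha> * l \<le> 1 - \<alpha>"
  shows "tau1 \<alpha> l = kernel_mass (2 * \<alpha> * l) (1 - \<alpha>)"
    and "gamma1 \<alpha> l = kernel_moment (2 * \<alpha> * l) (1 - \<alpha>)"
    and "gamma2 \<alpha> l = kernel_mass (2 * \<alpha> * l) (1 - \<alpha>) - kernel_moment (2 * \<alpha> * l) (1 - \<alpha>)"
  using assms
  by (simp_all add: tau1_def gamma1_def gamma2_def kernel_mass_def kernel_moment_def field_simps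
      power2_eq_square power3_eq_cube power4_eq_xxxx)

text \<open>At the boundary \<open>2 * \<alpha> * l = 1 - \<alpha>\<close> the kernel does not change sign and both pairs of
  formulas agree, so the nonstrict hypothesis is enough.\<close>

lemma kernel_ge:
  assumes "c \<le> p"
  shows "kernel_mass p c = p*c^2/2 - c^3/3" "kernel_moment p c = p*c^3/3 - c^4/4"
  using assms
  by (auto simp: kernel_mass_def kernel_moment_def field_simps
      power2_eq_square power3_eq_cube power4_eq_xxxx)

lemma tau2_gamma_eq_kernel:
  assumes "1 - \<alpha> \<le> 2 * \<alpha> * l"
  shows "tau2 \<alpha> l = kernel_mass (2 * \<alpha> * l) (1 - \<alpha>)"
    and "gamma3 \<alpha> l = kernel_moment (2 * \<alpha> * l) (1 - \<alpha>)"
    and "gamma4 \<alpha> l = kernel_mass (2 * \<alpha> * l) (1 - \<alpha>) - kernel_moment (2 * \<alpha> * l) (1 - \<alpha>)"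
  unfolding kernel_ge[OF assms]
  by (simp_all add: tau2_def gamma3_def gamma4_def field_simps
      power2_eq_square power3_eq_cube power4_eq_xxxx)

text \<open>On this side \<open>t\<close> is measured from \<open>b\<close>, so the moment is the
  weight of \<open>a\<close>, namely \<open>mu2\<close>, and the remaining mass \<open>mu1\<close>
  belongs to \<open>b\<close>: the reverse of \<open>gamma1\<close> and
  \<open>gamma2\<close>.\<close>

lemma z1_mu_eq_kernel:
  assumes "2 * l * (1 - \<alpha>) \<le> \<alpha>"
  shows "z1 \<alpha> l = kernel_mass (2 * l * (1 - \<alpha>)) \<alpha>"
    and "mu2 \<alpha> l = kernel_moment (2 * l * (1 - \<alpha>)) \<alpha>"
    and "mu1 \<alpha> l = kernel_mass (2 * l * (1 - \<alpha>)) \<alpha> - kernel_moment (2 * l * (1 - \<alpha>)) \<alpha>"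
  using assms
  by (simp_all add: z1_def mu1_def mu2_def kernel_mass_def kernel_moment_def field_simps
      power2_eq_square power3_eq_cube power4_eq_xxxx)

lemma z2_mu_eq_kernel:
  assumes "\<alpha> \<le> 2 * l * (1 - \<alpha>)"
  shows "z2 \<alpha> l = kernel_mass (2 * l * (1 - \<alpha>)) \<alpha>"
    and "mu4 \<alpha> l = kernel_moment (2 * l * (1 - \<alpha>)) \<alpha>"
    and "mu3 \<alpha> l = kernel_mass (2 * l * (1 - \<alpha>)) \<alpha> - kernel_moment (2 * l * (1 - \<alpha>)) \<alpha>"
  unfolding kernel_ge[OF assms]
  by (simp_all add: z2_def mu3_def mu4_def field_simps
      power2_eq_square power3_eq_cube power4_eq_xxxx)

section \<open>A primitive of the function and the final estimate\<close>

text \<open>The primitive is taken on a slightly larger compact interval inside \<open>J\<close>, so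
  that its derivative is two-sided at \<open>a\<close> and \<open>b\<close> too, as the kernel
  lemmas require.\<close>

lemma antiderivative_on_open_interval:
  fixes f :: "real \<Rightarrow> real"
  assumes J: "open J" "is_interval J" and cont: "continuous_on J f"
    and ab: "a \<in> J" "b \<in> J"
  obtains F where "\<And>x. a \<le> x \<Longrightarrow> x \<le> b \<Longrightarrow> (F has_real_derivative f x) (at x)"
proof -
  obtain e where e: "e > 0" "cball a e \<subseteq> J" using J ab open_contains_cball by metis
  obtain d where d: "d > 0" "cball b d \<subseteq> J" using J ab open_contains_cball by metis
  have "a - e \<in> J" "b + d \<in> J" using e d by (auto simp: dist_real_def subset_iff)
  hence "{a - e..b + d} \<subseteq> J" using J(2) by (meson atLeastAtMost_iff mem_is_interval_1_I subsetI)
  hence "continuous_on {a - e..b + d} f" using cont continuous_on_subset by blast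
  then obtain F where F: "\<And>x. x \<in> {a - e..b + d} \<Longrightarrow>
      (F has_vector_derivative f x) (at x within {a - e..b + d})"
    using antiderivative_continuous by blast
  have "(F has_real_derivative f x) (at x)" if x: "a \<le> x" "x \<le> b" for x
  proof -
    have "(F has_vector_derivative f x) (at x within {a - e..b + d})" using F x e d by simp
    moreover have "at x within {a - e..b + d} = at x"
      using x e d by (intro at_within_interior) simp
    ultimately show ?thesis by (simp add: has_real_derivative_iff_has_vector_derivative)
  qed
  then show ?thesis by (rule that)
qed

theorem theorem4:
  fixes I :: "real set" and f f' f'' :: "real \<Rightarrow> real" and a b \<alpha> l q :: real
  assumes "is_interval I"
    and "a \<in> interior I" and "b \<in> interior I" and "a < b"
    and "\<And>x. x \<in> interior I \<Longrightarrow> (f has_real_derivative f' x) (at x)"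
    and "\<And>x. x \<in> interior I \<Longrightarrow> (f' has_real_derivative f'' x) (at x)"
    and "set_integrable lebesgue {a..b} f"
    and "set_integrable lebesgue {a..b} f'"
    and "set_integrable lebesgue {a..b} f''"
    and "\<alpha> \<in> {0..1}" and "l \<in> {0..1}" and "q \<ge> 1"
    and "convex_on {a..b} (\<lambda>x. \<bar>f'' x\<bar> powr q)"
  shows
        "(2 * \<alpha> * l \<le> 1 - \<alpha> \<and> 1 - \<alpha> \<le> 1 - 2 * l * (1 - \<alpha>) \<longrightarrow>
          \<bar>quad_error f f' a b \<alpha> l\<bar> \<le> (b - a)^2 / 2 *
            (rpow (tau1 \<alpha> l) (1 - 1/q)
               * (gamma1 \<alpha> l * \<bar>f'' b\<bar> powr q + gamma2 \<alpha> l * \<bar>f'' a\<bar> powr q) powr (1/q)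
             + rpow (z1 \<alpha> l) (1 - 1/q)
               * (mu1 \<alpha> l * \<bar>f'' b\<bar> powr q + mu2 \<alpha> l * \<bar>f'' a\<bar> powr q) powr (1/q))) \<and>
         (1 - \<alpha> \<ge> max (2 * \<alpha> * l) (1 - 2 * l * (1 - \<alpha>)) \<longrightarrow>
          \<bar>quad_error f f' a b \<alpha> l\<bar> \<le> (b - a)^2 / 2 *
            (rpow (tau1 \<alpha> l) (1 - 1/q)
               * (gamma1 \<alpha> l * \<bar>f'' b\<bar> powr q + gamma2 \<alpha> l * \<bar>f'' a\<bar> powr q) powr (1/q)
             + rpow (z2 \<alpha> l) (1 - 1/q)
               * (mu3 \<alpha> l * \<bar>f'' b\<bar> powr q + mu4 \<alpha> l * \<bar>f'' a\<bar> powr q) powr (1/q))) \<and>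
         (1 - \<alpha> \<le> min (2 * \<alpha> * l) (1 - 2 * l * (1 - \<alpha>)) \<longrightarrow>
          \<bar>quad_error f f' a b \<alpha> l\<bar> \<le> (b - a)^2 / 2 *
            (rpow (tau2 \<alpha> l) (1 - 1/q)
               * (gamma3 \<alpha> l * \<bar>f'' b\<bar> powr q + gamma4 \<alpha> l * \<bar>f'' a\<bar> powr q) powr (1/q)
             + rpow (z1 \<alpha> l) (1 - 1/q)
               * (mu1 \<alpha> l * \<bar>f'' b\<bar> powr q + mu2 \<alpha> l * \<bar>f'' a\<bar> powr q) powr (1/q))) \<and>
         (1 - 2 * l * (1 - \<alpha>) \<le> 1 - \<alpha> \<and> 1 - \<alpha> \<le> 2 * \<alpha> * l \<longrightarrow>
          \<bar>quad_error f f' a b \<alpha> l\<bar> \<le> (b - a)^2 / 2 *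
            (rpow (tau2 \<alpha> l) (1 - 1/q)
               * (gamma3 \<alpha> l * \<bar>f'' b\<bar> powr q + gamma4 \<alpha> l * \<bar>f'' a\<bar> powr q) powr (1/q)
             + rpow (z2 \<alpha> l) (1 - 1/q)
               * (mu3 \<alpha> l * \<bar>f'' b\<bar> powr q + mu4 \<alpha> l * \<bar>f'' a\<bar> powr q) powr (1/q)))"
proof -
  note f = assms(5) and f' = assms(6) and ab = \<open>a < b\<close> and conv = assms(13)
  have \<alpha>: "0 \<le> \<alpha>" "\<alpha> \<le> 1" and l: "0 \<le> l" "l \<le> 1" using assms(10,11) by auto
  have J: "is_interval (interior I)"
    using assms(1) convex_interior is_interval_convex_1 by blast
  have in_I: "x \<in> interior I" if "a \<le> x" "x \<le> b" for x
    using J assms(2,3) that unfolding is_interval_1 by blast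
  have cont: "continuous_on (interior I) f"
    using f DERIV_isCont continuous_at_imp_continuous_on by blast
  obtain F where F: "\<And>x. a \<le> x \<Longrightarrow> x \<le> b \<Longrightarrow> (F has_real_derivative f x) (at x)"
    using antiderivative_on_open_interval[OF open_interior J cont assms(2,3)] by metis
  have "(f has_integral (F b - F a)) {a..b}"
    using ab F by (intro fundamental_theorem_of_calculus)
      (auto simp flip: has_real_derivative_iff_has_vector_derivative
        intro: has_field_derivative_at_within)
  hence int: "(LINT x:{a..b}|lebesgue. f x) = F b - F a"
    using set_lebesgue_integral_eq_integral(2)[OF assms(7)] by (simp add: integral_unique)
  define w where "w = b - a"
  have w: "0 < w" using ab by (simp add: w_def)
  have left: "a \<le> a + t * w" "a + t * w \<le> b" if "0 \<le> t" "t \<le> 1" for t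
    using mult_left_le_one_le[OF less_imp_le[OF w] that]
      mult_nonneg_nonneg[OF that(1) less_imp_le[OF w]] w_def by linarith+
  have right: "a \<le> b - t * w" "b - t * w \<le> b" if "0 \<le> t" "t \<le> 1" for t
    using mult_left_le_one_le[OF less_imp_le[OF w] that]
      mult_nonneg_nonneg[OF that(1) less_imp_le[OF w]] w_def by linarith+
  define A where "A = \<bar>f'' a\<bar> powr q"
  define B where "B = \<bar>f'' b\<bar> powr q"
  have AB: "0 \<le> A" "0 \<le> B" by (auto simp: A_def B_def)
  have cvx: "\<bar>f'' (a + t * w)\<bar> powr q \<le> t * B + (1 - t) * A" if "0 \<le> t" "t \<le> 1" for t
    using convex_onD[OF conv, of t a b] that ab
    by (simp add: A_def B_def w_def algebra_simps)
  define p where "p = 2 * \<alpha> * l"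
  define r where "r = 2 * l * (1 - \<alpha>)"
  define c where "c = 1 - \<alpha>"
  \<comment> \<open>The node is reached from \<open>a\<close> at \<open>t = c\<close> and from
    \<open>b\<close> at \<open>t = \<alpha>\<close>.\<close>
  define x where "x = a + c * w"
  have p: "0 \<le> p" and r: "0 \<le> r" and c: "0 \<le> c" "c \<le> 1"
    using \<alpha> l by (auto simp: p_def r_def c_def)
  have x: "(1 - \<alpha>) * b + \<alpha> * a = x" "b - \<alpha> * w = x"
    by (auto simp: x_def c_def w_def algebra_simps)
  \<comment> \<open>\<open>T\<close> comes from \<open>g t = f (a + t * w)\<close> with primitive
    \<open>F (a + t * w) / w\<close>, and \<open>S\<close> from \<open>g t = f (b - t * w)\<close>
    with primitive \<open>- F (b - t * w) / w\<close>.\<close>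
  define T where "T = c * (c - p) * (w * f' x) - (2 * c - p) * f x - p * f a + 2 * (F x / w - F a / w)"
  define S where "S = \<alpha> * (\<alpha> - r) * (- w * f' x) - (2 * \<alpha> - r) * f x - r * f b
    + 2 * (- F x / w - - F b / w)"
  define P where "P = rpow (kernel_mass p c) (1 - 1/q) *
      (kernel_moment p c * B + (kernel_mass p c - kernel_moment p c) * A) powr (1/q)"
  define R where "R = rpow (kernel_mass r \<alpha>) (1 - 1/q) *
      ((kernel_mass r \<alpha> - kernel_moment r \<alpha>) * B + kernel_moment r \<alpha> * A) powr (1/q)"
  have "\<bar>T\<bar> \<le> w^2 * P"
  proof -
    have "\<bar>c * (c - p) * (w * f' (a + c * w)) - (2 * c - p) * f (a + c * w) - p * f (a + 0 * w)
        + 2 * (F (a + c * w) / w - F (a + 0 * w) / w)\<bar> \<le> w^2 * P"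
      unfolding P_def
    proof (rule kernel_integral_bound[OF p c \<open>q \<ge> 1\<close> AB])
      show "0 < w^2" using w by simp
      fix t assume "0 \<le> t" "t \<le> c"
      hence t: "0 \<le> t" "t \<le> 1" using c by auto
      have d: "((\<lambda>t. a + t * w) has_real_derivative w) (at t)"
        by (auto intro!: derivative_eq_intros)
      show "((\<lambda>t. F (a + t * w) / w) has_real_derivative f (a + t * w)) (at t)"
        using DERIV_cdivide[OF DERIV_chain2[OF F[OF left[OF t]] d], of w] w by simp
      show "((\<lambda>t. f (a + t * w)) has_real_derivative w * f' (a + t * w)) (at t)"
        using DERIV_chain2[OF f[OF in_I[OF left[OF t]]] d] by (simp add: mult.commute)
      show "((\<lambda>t. w * f' (a + t * w)) has_real_derivative w^2 * f'' (a + t * w)) (at t)"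
        using DERIV_cmult[OF DERIV_chain2[OF f'[OF in_I[OF left[OF t]]] d], of w]
        by (simp add: mult_ac power2_eq_square)
      show "\<bar>f'' (a + t * w)\<bar> powr q \<le> t * B + (1 - t) * A" by (rule cvx[OF t])
    qed
    then show ?thesis by (simp add: T_def x_def)
  qed
  moreover have "\<bar>S\<bar> \<le> w^2 * R"
  proof -
    have "\<bar>\<alpha> * (\<alpha> - r) * (- w * f' (b - \<alpha> * w)) - (2 * \<alpha> - r) * f (b - \<alpha> * w) - r * f (b - 0 * w)
        + 2 * (- F (b - \<alpha> * w) / w - - F (b - 0 * w) / w)\<bar> \<le> w^2 *
        (rpow (kernel_mass r \<alpha>) (1 - 1/q) *
        (kernel_moment r \<alpha> * A + (kernel_mass r \<alpha> - kernel_moment r \<alpha>) * B) powr (1/q))"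
    \<comment> \<open>The parameter starts at \<open>b\<close>, so \<open>A\<close> and
      \<open>B\<close> change places. Reversal flips the sign of the first derivative but not of the
      second.\<close>
    proof (rule kernel_integral_bound[OF r \<alpha> \<open>q \<ge> 1\<close> AB(2,1)])
      show "0 < w^2" using w by simp
      fix t assume "0 \<le> t" "t \<le> \<alpha>"
      hence t: "0 \<le> t" "t \<le> 1" using \<alpha> by auto
      have d: "((\<lambda>t. b - t * w) has_real_derivative - w) (at t)"
        by (auto intro!: derivative_eq_intros)
      show "((\<lambda>t. - F (b - t * w) / w) has_real_derivative f (b - t * w)) (at t)"
        using DERIV_cdivide[OF DERIV_minus[OF DERIV_chain2[OF F[OF right[OF t]] d]], of w] w by simp
      show "((\<lambda>t. f (b - t * w)) has_real_derivative - w * f' (b - t * w)) (at t)"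
        using DERIV_chain2[OF f[OF in_I[OF right[OF t]]] d] by (simp add: mult.commute)
      show "((\<lambda>t. - w * f' (b - t * w)) has_real_derivative w^2 * f'' (b - t * w)) (at t)"
        using DERIV_cmult[OF DERIV_chain2[OF f'[OF in_I[OF right[OF t]]] d], of "- w"]
        by (simp add: mult_ac power2_eq_square)
      have "b - t * w = a + (1 - t) * w" by (simp add: w_def algebra_simps)
      then show "\<bar>f'' (b - t * w)\<bar> powr q \<le> t * A + (1 - t) * B"
        using cvx[of "1 - t"] t by (simp add: add.commute)
    qed
    then show ?thesis unfolding x(2) by (simp add: S_def R_def add.commute)
  qed
  \<comment> \<open>As \<open>p * c = r * \<alpha>\<close>, the terms in \<open>l\<close> at
    \<open>f' x\<close> cancel and leave \<open>(1 - 2 * \<alpha>) * w\<close>; as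
    \<open>p + r = 2 * l\<close>, the coefficient of \<open>f x\<close> is
    \<open>- 2 * (1 - l)\<close>. The two occurrences of \<open>F x\<close> cancel.\<close>
  moreover have "quad_error f f' a b \<alpha> l = - (T + S) / 2"
    unfolding quad_error_def x(1) int T_def S_def p_def r_def c_def w_def[symmetric]
    using w by (simp add: field_simps)
  ultimately have "\<bar>quad_error f f' a b \<alpha> l\<bar> \<le> (w^2 * P + w^2 * R) / 2"
    unfolding abs_le_iff by auto
  hence *: "\<bar>quad_error f f' a b \<alpha> l\<bar> \<le> (b - a)^2 / 2 * (P + R)" by (simp add: w_def distrib_left)
  \<comment> \<open>The halves are independent: comparing \<open>p\<close> with \<open>c\<close>
    fixes the form of \<open>P\<close>, comparing \<open>r\<close> with \<open>\<alpha>\<close> that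
    of \<open>R\<close>, and the four cases are the combinations.\<close>
  have P1: "P = rpow (tau1 \<alpha> l) (1 - 1/q) * (gamma1 \<alpha> l * B + gamma2 \<alpha> l * A) powr (1/q)"
    if "2 * \<alpha> * l \<le> 1 - \<alpha>"
    by (simp add: P_def p_def c_def tau1_gamma_eq_kernel[OF that])
  have P2: "P = rpow (tau2 \<alpha> l) (1 - 1/q) * (gamma3 \<alpha> l * B + gamma4 \<alpha> l * A) powr (1/q)"
    if "1 - \<alpha> \<le> 2 * \<alpha> * l"
    by (simp add: P_def p_def c_def tau2_gamma_eq_kernel[OF that])
  have R1: "R = rpow (z1 \<alpha> l) (1 - 1/q) * (mu1 \<alpha> l * B + mu2 \<alpha> l * A) powr (1/q)"
    if "1 - \<alpha> \<le> 1 - 2 * l * (1 - \<alpha>)"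
    using that by (simp add: R_def r_def z1_mu_eq_kernel)
  have R2: "R = rpow (z2 \<alpha> l) (1 - 1/q) * (mu3 \<alpha> l * B + mu4 \<alpha> l * A) powr (1/q)"
    if "1 - 2 * l * (1 - \<alpha>) \<le> 1 - \<alpha>"
    using that by (simp add: R_def r_def z2_mu_eq_kernel)
  show ?thesis
    unfolding A_def[symmetric] B_def[symmetric] max.bounded_iff min.bounded_iff
  proof (intro conjI impI; elim conjE)
    assume "2 * \<alpha> * l \<le> 1 - \<alpha>" "1 - \<alpha> \<le> 1 - 2 * l * (1 - \<alpha>)"
    from *[unfolded P1[OF this(1)] R1[OF this(2)]] show "\<bar>quad_error f f' a b \<alpha> l\<bar> \<le> (b - a)^2 / 2 *
            (rpow (tau1 \<alpha> l) (1 - 1/q) * (gamma1 \<alpha> l * B + gamma2 \<alpha> l * A) powr (1/q)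
             + rpow (z1 \<alpha> l) (1 - 1/q) * (mu1 \<alpha> l * B + mu2 \<alpha> l * A) powr (1/q))" .
  next
    assume "2 * \<alpha> * l \<le> 1 - \<alpha>" "1 - 2 * l * (1 - \<alpha>) \<le> 1 - \<alpha>"
    from *[unfolded P1[OF this(1)] R2[OF this(2)]] show "\<bar>quad_error f f' a b \<alpha> l\<bar> \<le> (b - a)^2 / 2 *
            (rpow (tau1 \<alpha> l) (1 - 1/q) * (gamma1 \<alpha> l * B + gamma2 \<alpha> l * A) powr (1/q)
             + rpow (z2 \<alpha> l) (1 - 1/q) * (mu3 \<alpha> l * B + mu4 \<alpha> l * A) powr (1/q))" .
  next
    assume "1 - \<alpha> \<le> 2 * \<alpha> * l" "1 - \<alpha> \<le> 1 - 2 * l * (1 - \<alpha>)"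
    from *[unfolded P2[OF this(1)] R1[OF this(2)]] show "\<bar>quad_error f f' a b \<alpha> l\<bar> \<le> (b - a)^2 / 2 *
            (rpow (tau2 \<alpha> l) (1 - 1/q) * (gamma3 \<alpha> l * B + gamma4 \<alpha> l * A) powr (1/q)
             + rpow (z1 \<alpha> l) (1 - 1/q) * (mu1 \<alpha> l * B + mu2 \<alpha> l * A) powr (1/q))" .
  next
    assume "1 - 2 * l * (1 - \<alpha>) \<le> 1 - \<alpha>" "1 - \<alpha> \<le> 2 * \<alpha> * l"
    from *[unfolded P2[OF this(2)] R2[OF this(1)]] show "\<bar>quad_error f f' a b \<alpha> l\<bar> \<le> (b - a)^2 / 2 *
            (rpow (tau2 \<alpha> l) (1 - 1/q) * (gamma3 \<alpha> l * B + gamma4 \<alpha> l * A) powr (1/q)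
             + rpow (z2 \<alpha> l) (1 - 1/q) * (mu3 \<alpha> l * B + mu4 \<alpha> l * A) powr (1/q))" .
  qed
qed

end
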